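(* Let $\mathbb{K}$ be an arbitrary (commutative) field, let $n \geq 1$ be an integer, and let $A \in \mathrm{M}_n(\mathbb{K})$ be a singular matrix of rank $p$ (so $0 \le p < n$). Then the sub-semigroup of $(\mathrm{M}_n(\mathbb{K}),\times)$ generated by the similarity class $\{PAP^{-1} : P \in \mathrm{GL}_n(\mathbb{K})\}$ of $A$ is $$S_p := \bigl\{M \in \mathrm{M}_n(\mathbb{K}) : \operatorname{rk} M \leq p\bigr\}.$$
   Context: $\mathrm{M}_n(\mathbb{K})$ is the algebra of $n\times n$ matrices with entries in $\mathbb{K}$, $\mathrm{GL}_n(\mathbb{K})$ is its group of invertible elements, and $\operatorname{rk}$ denotes rank. The sub-semigroup generated by a subset $X$ of $(\mathrm{M}_n(\mathbb{K}),\times)$ is the set of all finite products $X_1 X_2\cdots X_m$ with $m \geq 1$ and $X_1,\dots,X_m \in X$ (the identity matrix is not adjoined as an empty product). *)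

theory Defs
  imports "HOL-Analysis.Cartesian_Space"
begin

definition similarity_class :: "'k::field^'n^'n \<Rightarrow> ('k^'n^'n) set" where
  "similarity_class A = {P ** A ** matrix_inv P | P. invertible P}"

text \<open>
  All products of a nonempty list \<open>Y # Ys\<close> of elements of \<open>X\<close>; the identity matrix
  is not adjoined as an empty product.
\<close>

definition generated_semigroup :: "('k::field^'n^'n) set \<Rightarrow> ('k^'n^'n) set" where
  "generated_semigroup X = {foldl (**) Y Ys | Y Ys. Y \<in> X \<and> set Ys \<subseteq> X}"

end

theory Submission
  imports Defs
begin

text \<open>
  Let \<open>S\<close> be the semigroup generated by the conjugates of \<open>A\<close>. If \<open>B\<close> is such a conjugate and \<open>B e\<^sub>i = 0\<close>,
  then every invertible \<open>h\<close> differing from the identity only in row \<open>i\<close> satisfies \<open>B h = B\<close>, so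
  \<open>h B = h B h\<inverse>\<close> is again a conjugate of \<open>A\<close>. Since moreover \<open>g (B N) = (g B g\<inverse>) (g N)\<close>, a product
  of conjugates whose factors annihilate \<open>e\<^sub>i\<close>, for \<open>i\<close> running through a suitable sequence, can be multiplied
  from the left by any \<open>h\<^sub>k \<cdots> h\<^sub>1\<close> with \<open>h\<^sub>j\<close> of the above kind for the successive \<open>i\<close>, without leaving \<open>S\<close>.
  Gaussian elimination gives one finite sequence of row indices that serves all invertible matrices at once,
  and because \<open>A\<close> is singular the factors can be chosen so that the product \<open>N\<close> keeps rank \<open>p\<close>. Thus
  \<open>g N \<in> S\<close> for all invertible \<open>g\<close>; as \<open>S\<close> is closed under conjugation, it contains every matrix of rank \<open>p\<close>,
  and then products of two matrices lower the rank one step at a time.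
\<close>

subsection \<open>Rank and bases over an arbitrary field\<close>

text \<open>HOL-Analysis identifies row rank and column rank only for real matrices.\<close>

lemma dim_columns_le_dim_rows:
  fixes A :: "'k::field^'n^'m"
  shows "vec.dim (columns A) \<le> vec.dim (rows A)"
proof -
  obtain B where B: "vec.independent B" "rows A \<subseteq> vec.span B" "card B = vec.dim (rows A)"
    by (rule vec.basis_exists)
  have fin: "finite B"
    using B(1) by (rule vec.finiteI_independent)
  have "\<exists>c. row i A = (\<Sum>b\<in>B. c b *s b)" for i
    using B(2) by (auto simp: rows_def vec.span_finite[OF fin])
  then obtain c where c: "\<And>i. row i A = (\<Sum>b\<in>B. c i b *s b)"
    by metis
  have "column j A = (\<Sum>b\<in>B. b $ j *s (\<chi> i. c i b))" for j
  proof (rule vec_eq_iff[THEN iffD2], rule allI)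
    fix i
    have "column j A $ i = row i A $ j"
      by (simp add: column_def row_def)
    then show "column j A $ i = (\<Sum>b\<in>B. b $ j *s (\<chi> i. c i b)) $ i"
      by (simp add: c mult.commute)
  qed
  then have "columns A \<subseteq> vec.span ((\<lambda>b. \<chi> i. c i b) ` B)"
    by (auto simp: columns_def intro!: vec.span_sum vec.span_scale intro: vec.span_base)
  then have "vec.dim (columns A) \<le> card ((\<lambda>b. \<chi> i. c i b) ` B)"
    using fin by (intro vec.dim_le_card) auto
  then show ?thesis
    using card_image_le[OF fin, of "\<lambda>b. \<chi> i. c i b"] B(3) by simp
qed

lemma span_columns_eq_range:
  fixes A :: "'k::field^'n^'m"
  shows "vec.span (columns A) = range ((*v) A)"
proof
  have "column j A \<in> range ((*v) A)" for j
    by (rule range_eqI[of _ _ "axis j 1"])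
      (simp add: vec_eq_iff column_def matrix_vector_mult_def axis_def if_distrib cong: if_cong)
  then have "columns A \<subseteq> range ((*v) A)"
    by (auto simp: columns_def)
  then show "vec.span (columns A) \<subseteq> range ((*v) A)"
    by (intro vec.span_minimal vec.linear_subspace_image matrix_vector_mul_linear_gen vec.subspace_UNIV)
qed (auto simp: matrix_vector_mult_in_columnspace_gen)

lemma rank_eq_dim_range:
  fixes A :: "'k::field^'n^'m"
  shows "rank A = vec.dim (range ((*v) A))"
proof -
  have "vec.dim (rows A) = vec.dim (columns A)"
    using dim_columns_le_dim_rows[of A] dim_columns_le_dim_rows[of "transpose A"]
    by (simp add: rows_transpose columns_transpose)
  then show ?thesis
    by (metis row_rank_def_gen span_columns_eq_range vec.dim_span)
qed

lemma rank_mult_le_left: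
  fixes A :: "'k::field^'n^'m" and B :: "'k^'l^'n"
  shows "rank (A ** B) \<le> rank A"
  unfolding rank_eq_dim_range
  by (rule vec.dim_subset) (auto simp: matrix_vector_mul_assoc[symmetric])

lemma rank_mult_le_right:
  fixes A :: "'k::field^'n^'m" and B :: "'k^'l^'n"
  shows "rank (A ** B) \<le> rank B"
proof -
  have "range ((*v) (A ** B)) = (*v) A ` range ((*v) B)"
    by (auto simp: matrix_vector_mul_assoc[symmetric])
  then show ?thesis
    unfolding rank_eq_dim_range by (simp add: vec.dim_image_le)
qed

lemma invertible_iff_rank:
  fixes A :: "'k::field^'n^'n"
  shows "invertible A \<longleftrightarrow> rank A = CARD('n)"
proof -
  have "rank A = CARD('n) \<longleftrightarrow> vec.span (range ((*v) A)) = UNIV"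
    using vec.dim_eq_full[of "range ((*v) A)"]
    by (simp add: rank_eq_dim_range vec.dimension_def card_cart_basis)
  also have "\<dots> \<longleftrightarrow> surj ((*v) A)"
    by (metis span_columns_eq_range vec.span_span)
  finally show ?thesis
    by (simp add: invertible_right_inverse matrix_right_invertible_surjective)
qed

lemma rank_mult_invertible_right:
  fixes A :: "'k::field^'n^'m" and P :: "'k^'n^'n"
  assumes "invertible P"
  shows "rank (A ** P) = rank A"
proof (rule antisym)
  obtain Q where "P ** Q = mat 1"
    using assms by (auto simp: invertible_def)
  then have "A = A ** P ** Q"
    by (metis matrix_mul_assoc matrix_mul_rid)
  then show "rank A \<le> rank (A ** P)"
    by (metis rank_mult_le_left)
qed (rule rank_mult_le_left)

lemma rank_mult_invertible_left:
  fixes A :: "'k::field^'n^'m" and P :: "'k^'m^'m"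
  assumes "invertible P"
  shows "rank (P ** A) = rank A"
proof (rule antisym)
  obtain Q where "Q ** P = mat 1"
    using assms by (auto simp: invertible_def)
  then have "A = Q ** (P ** A)"
    by (metis matrix_mul_assoc matrix_mul_lid)
  then show "rank A \<le> rank (P ** A)"
    by (metis rank_mult_le_right)
qed (rule rank_mult_le_right)

text \<open>An injective linear extension of \<open>f\<close> exists, and an injective endomorphism
  in finite dimension is invertible. Below, invertible matrices are thus built by prescribing them
  on a few vectors.\<close>

lemma invertible_extending:
  fixes f :: "'k::field^'n \<Rightarrow> 'k^'n"
  assumes "vec.independent B" "inj_on f B" "vec.independent (f ` B)"
  obtains Q :: "'k^'n^'n" where "invertible Q" "\<And>b. b \<in> B \<Longrightarrow> Q *v b = f b"
proof -
  obtain g where g: "Vector_Spaces.linear (*s) (*s) g" "inj g" "\<And>b. b \<in> B \<Longrightarrow> g b = f b"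
    using vec.linear_independent_extend_inj[OF assms(1,3,2)] by blast
  have "(*v) (matrix g) = g"
    using g(1) by (intro ext) (rule matrix_works)
  then show ?thesis
    using that[of "matrix g"] g by (auto simp: invertible_left_inverse matrix_left_invertible_injective)
qed

section \<open>Bases adapted to a matrix, and equivalence of matrices of equal rank\<close>

lemma independent_Un_kernel:
  fixes A :: "'k::field^'n^'m"
  assumes "inj_on ((*v) A) W" "vec.independent ((*v) A ` W)"
    and "vec.independent K" "\<And>k. k \<in> K \<Longrightarrow> A *v k = 0"
  shows "vec.independent (W \<union> K)"
proof -
  have "finite ((*v) A ` W)"
    using assms(2) by (rule vec.finiteI_independent)
  then have "finite W"
    using assms(1) finite_imageD by blast
  then show ?thesis
    using assms(1,2)
  proof (induction W)
    case empty
    then show ?case using assms(3) by simp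
  next
    case (insert w W)
    have notin: "A *v w \<notin> vec.span ((*v) A ` W)"
    proof -
      have "A *v w \<notin> (*v) A ` W"
        using insert.hyps(2) insert.prems(1) by (auto simp: inj_on_def)
      then show ?thesis
        using insert.prems(2) by (simp add: vec.independent_insert)
    qed
    have "(*v) A ` vec.span (W \<union> K) \<subseteq> vec.span ((*v) A ` W)"
    proof -
      have "(*v) A ` (W \<union> K) \<subseteq> vec.span ((*v) A ` W)"
        using assms(4) by (auto intro: vec.span_base vec.span_zero)
      then show ?thesis
        by (metis vec.span_image vec.span_minimal vec.subspace_span)
    qed
    \<comment> \<open>As \<open>A\<close> kills \<open>K\<close>, it maps the span of
      \<open>W \<union> K\<close> into that of the images of \<open>W\<close>, which misses
      \<open>A *v w\<close>.\<close>
    with notin have "w \<notin> vec.span (W \<union> K)"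
      by blast
    moreover have "vec.independent (W \<union> K)"
      using insert.prems by (intro insert.IH) (auto simp: inj_on_def dest: vec.independent_mono[OF _ subset_insertI])
    ultimately show ?case
      by (simp add: vec.independent_insertI)
  qed
qed

text \<open>\<open>W\<close> lifts a basis of the range and \<open>K\<close> is a basis of the
  kernel. They span together because each \<open>v\<close> differs from some \<open>w\<close> in the
  span of \<open>W\<close> by a kernel vector.\<close>

lemma adapted_basis:
  fixes A :: "'k::field^'n^'m"
  obtains W K where "vec.independent (W \<union> K)" "vec.span (W \<union> K) = UNIV" "W \<inter> K = {}"
    "inj_on ((*v) A) W" "vec.independent ((*v) A ` W)" "card W = rank A"
    "\<forall>k\<in>K. A *v k = 0" "card W + card K = CARD('n)"
proof -
  obtain C where C: "C \<subseteq> range ((*v) A)" "vec.independent C" "range ((*v) A) \<subseteq> vec.span C"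
    "card C = vec.dim (range ((*v) A))"
    by (rule vec.basis_exists)
  obtain W where W: "inj_on ((*v) A) W" "C = (*v) A ` W"
    using C(1) by (auto simp: subset_image_inj)
  obtain K where K: "K \<subseteq> {x. A *v x = 0}" "vec.independent K" "{x. A *v x = 0} \<subseteq> vec.span K"
    by (rule vec.basis_exists)
  have indep: "vec.independent (W \<union> K)"
    using W C(2) K by (intro independent_Un_kernel) auto
  have "v \<in> vec.span (W \<union> K)" for v
  proof -
    have "A *v v \<in> (*v) A ` vec.span W"
      using C(3) W(2) by (auto simp: vec.span_image)
    then obtain w where w: "w \<in> vec.span W" "A *v v = A *v w"
      by blast
    then have "v - w \<in> vec.span K"
      using K(3) by (auto simp: vec.diff)
    then have "w + (v - w) \<in> vec.span (W \<union> K)"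
      using w(1) by (intro vec.span_add) (auto intro: vec.span_mono[THEN subsetD])
    then show ?thesis by simp
  qed
  then have span: "vec.span (W \<union> K) = UNIV"
    by blast
  have disj: "W \<inter> K = {}"
  proof -
    have "0 \<notin> (*v) A ` W"
      using C(2) W(2) vec.dependent_zero by blast
    then show ?thesis using K(1) by auto
  qed
  have "card W + card K = card (W \<union> K)"
    using vec.finiteI_independent[OF indep] disj by (simp add: card_Un_disjoint)
  also have "\<dots> = vec.dim (UNIV :: ('k^'n) set)"
    using vec.dim_eq_card[OF _ indep] span by (metis vec.dim_span)
  finally have "card W + card K = CARD('n)"
    by (simp only: vec_dim_card)
  moreover have "card W = rank A"
    using W C(4) by (simp add: rank_eq_dim_range card_image)
  ultimately show thesis
    using that[of W K] indep span disj W C(2) K(1) by blast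
qed

text \<open>\<open>Q\<close> carries a basis adapted to \<open>M\<close> to one adapted to
  \<open>N\<close>; \<open>P\<close> then corrects the values on the range of
  \<open>N\<close>.\<close>

lemma same_rank_equivalent:
  fixes M N :: "'k::field^'n^'n"
  assumes "rank M = rank N"
  obtains P Q where "invertible P" "invertible Q" "M = P ** N ** Q"
proof -
  obtain W K where M: "vec.independent (W \<union> K)" "vec.span (W \<union> K) = UNIV" "W \<inter> K = {}"
    "inj_on ((*v) M) W" "vec.independent ((*v) M ` W)" "card W = rank M"
    "\<forall>k\<in>K. M *v k = 0" "card W + card K = CARD('n)"
    by (rule adapted_basis[of M])
  obtain W' K' where N: "vec.independent (W' \<union> K')" "W' \<inter> K' = {}"
    "inj_on ((*v) N) W'" "vec.independent ((*v) N ` W')" "card W' = rank N"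
    "\<forall>k\<in>K'. N *v k = 0" "card W' + card K' = CARD('n)"
    by (metis adapted_basis[of N])
  have fin: "finite W" "finite K" "finite W'" "finite K'"
    using vec.finiteI_independent[OF M(1)] vec.finiteI_independent[OF N(1)] by auto
  have card: "card W = card W'" "card K = card K'"
    using M(6,8) N(5,7) assms by auto
  obtain f where f: "bij_betw f W W'"
    using finite_same_card_bij[OF fin(1,3) card(1)] by blast
  obtain g where g: "bij_betw g K K'"
    using finite_same_card_bij[OF fin(2,4) card(2)] by blast
  define h where "h x = (if x \<in> W then f x else g x)" for x
  have hW: "bij_betw h W W'"
    using f by (simp add: h_def cong: bij_betw_cong)
  have hK: "bij_betw h K K'"
  proof -
    have "h x = g x" if "x \<in> K" for x
      using that M(3) by (auto simp: h_def)
    then show ?thesis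
      using g by (simp cong: bij_betw_cong)
  qed
  have h: "bij_betw h (W \<union> K) (W' \<union> K')"
    using hW hK N(2) by (rule bij_betw_combine)
  obtain Q where Q: "invertible Q" "\<And>b. b \<in> W \<union> K \<Longrightarrow> Q *v b = h b"
    using invertible_extending[of "W \<union> K" h] M(1) N(1) h by (auto simp: bij_betw_def)
  \<comment> \<open>The values for \<open>P\<close>: \<open>N *v h w\<close> has to go to
    \<open>M *v w\<close>. The inverse is meaningful because \<open>N\<close> and \<open>h\<close>
    are injective on \<open>W'\<close> and \<open>W\<close>.\<close>
  define u where "u y = M *v inv_into W (\<lambda>w. N *v h w) y" for y
  have inj: "inj_on (\<lambda>w. N *v h w) W"
    using comp_inj_on[of h W "(*v) N"] hW N(3) by (simp add: bij_betw_def o_def)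
  have u: "u (N *v h w) = M *v w" if "w \<in> W" for w
    using inv_into_f_f[OF inj that] by (simp add: u_def)
  have NW: "(*v) N ` W' = (\<lambda>w. N *v h w) ` W"
    using hW by (auto simp: bij_betw_def)
  have uW: "u ` (*v) N ` W' = (*v) M ` W"
    unfolding NW image_image by (intro image_cong) (auto simp: u)
  have "inj_on u ((*v) N ` W')"
    unfolding NW using M(4) by (auto simp: inj_on_def u)
  then obtain P where P: "invertible P" "\<And>y. y \<in> (*v) N ` W' \<Longrightarrow> P *v y = u y"
    using invertible_extending[of "(*v) N ` W'" u] N(4) M(5) uW by auto
  have "M *v b = P ** N ** Q *v b" if "b \<in> W \<union> K" for b
  proof (cases "b \<in> W")
    case True
    then have "P *v (N *v h b) = M *v b"
      using P(2)[of "N *v h b"] NW u by auto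
    then show ?thesis
      using True Q(2) by (simp add: matrix_vector_mul_assoc[symmetric])
  next
    case False
    with that have "b \<in> K" by simp
    moreover from this have "h b \<in> K'"
      using hK by (auto simp: bij_betw_def)
    ultimately show ?thesis
      using Q(2) M(7) N(6) by (simp add: matrix_vector_mul_assoc[symmetric])
  qed
  then have "M *v x = P ** N ** Q *v x" for x
    using vec.linear_eq_on[OF matrix_vector_mul_linear_gen matrix_vector_mul_linear_gen, of x "W \<union> K"] M(2)
    by blast
  then have "M = P ** N ** Q"
    by (simp add: matrix_eq)
  with P(1) Q(1) show thesis by (rule that)
qed

section \<open>Controlling the rank of a product with a singular factor\<close>

lemma rank_mult_of_image_basis:
  fixes T :: "'k::field^'n^'m" and N :: "'k^'l^'n"
  assumes "range ((*v) N) = vec.span (B \<union> Z)" "inj_on ((*v) T) B" "vec.independent ((*v) T ` B)"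
    and "\<And>z. z \<in> Z \<Longrightarrow> T *v z = 0"
  shows "rank (T ** N) = card B"
proof -
  have "range ((*v) (T ** N)) = (*v) T ` range ((*v) N)"
    by (auto simp: matrix_vector_mul_assoc[symmetric])
  also have "\<dots> = vec.span ((*v) T ` B \<union> (*v) T ` Z)"
    by (simp only: assms(1) vec.span_image[symmetric] image_Un)
  also have "\<dots> = vec.span ((*v) T ` B)"
  proof (rule vec.span_eq[THEN iffD2], intro conjI)
    show "(*v) T ` B \<union> (*v) T ` Z \<subseteq> vec.span ((*v) T ` B)"
      using assms(4) by (auto intro: vec.span_base vec.span_zero)
  qed (auto intro: vec.span_base)
  finally show ?thesis
    using vec.dim_span_eq_card_independent[OF assms(3)] assms(2)
    by (simp add: rank_eq_dim_range card_image)
qed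


text \<open>Singularity provides a basis vector \<open>k\<close> of the kernel. Let \<open>Q\<close>
  send \<open>x\<close> to \<open>k\<close> and \<open>B\<close> injectively into a lifted basis
  \<open>W\<close> of the range, which is large enough since
  \<open>card B \<le> rank A\<close>.\<close>

lemma invertible_annihilating:
  fixes A :: "'k::field^'n^'n" and x :: "'k^'n"
  assumes "\<not> invertible A" "vec.independent B" "x \<notin> vec.span B" "card B \<le> rank A"
  obtains Q :: "'k^'n^'n" where "invertible Q" "(A ** Q) *v x = 0"
    "inj_on ((*v) (A ** Q)) B" "vec.independent ((*v) (A ** Q) ` B)"
proof -
  obtain W K where A: "vec.independent (W \<union> K)" "vec.span (W \<union> K) = UNIV" "W \<inter> K = {}"
    "inj_on ((*v) A) W" "vec.independent ((*v) A ` W)" "card W = rank A"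
    "\<forall>k\<in>K. A *v k = 0" "card W + card K = CARD('n)"
    by (rule adapted_basis[of A])
  have "rank A \<noteq> CARD('n)"
    using assms(1) by (simp add: invertible_iff_rank)
  then obtain k where k: "k \<in> K"
    using A(6,8) by (cases "K = {}") auto
  obtain W' where W': "W' \<subseteq> W" "card W' = card B" "finite W'"
    using assms(4) A(6) obtain_subset_with_card_n[of "card B" W] by auto
  obtain f where f: "bij_betw f B W'"
    using finite_same_card_bij[OF vec.finiteI_independent[OF assms(2)] W'(3)] W'(2) by auto
  have x: "x \<notin> B"
    using assms(3) vec.span_base by blast
  define h where "h = f(x := k)"
  have hB: "h b = f b" if "b \<in> B" for b
    using that x by (auto simp: h_def)
  have h_img: "h ` insert x B = insert k W'"
    using f x by (auto simp: h_def bij_betw_def)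
  have "k \<notin> W'"
    using k W'(1) A(3) by blast
  then have inj: "inj_on h (insert x B)"
    using f x by (auto simp: h_def bij_betw_def inj_on_def)
  have "vec.independent (insert k W')"
    using k W'(1) by (intro vec.independent_mono[OF A(1)]) auto
  moreover have "vec.independent (insert x B)"
    using assms(2,3) by (rule vec.independent_insertI[rotated])
  ultimately obtain Q where Q: "invertible Q" "\<And>b. b \<in> insert x B \<Longrightarrow> Q *v b = h b"
    using invertible_extending[of "insert x B" h] inj unfolding h_img by blast
  have AQ: "(A ** Q) *v b = A *v f b" if "b \<in> B" for b
    using that Q(2)[of b] hB[of b] by (simp flip: matrix_vector_mul_assoc)
  have "(A ** Q) *v x = 0"
    using Q(2)[of x] k A(7) by (simp add: h_def flip: matrix_vector_mul_assoc)
  moreover have "inj_on ((*v) (A ** Q)) B"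
  proof (rule inj_onI)
    fix a b
    assume ab: "a \<in> B" "b \<in> B" "(A ** Q) *v a = (A ** Q) *v b"
    then have "A *v f a = A *v f b" "f a \<in> W" "f b \<in> W"
      using bij_betwE[OF f] W'(1) by (auto simp: AQ)
    then have "f a = f b"
      by (rule inj_onD[OF A(4)])
    then show "a = b"
      using ab(1,2) by (rule inj_onD[OF bij_betw_imp_inj_on[OF f]])
  qed
  moreover have "(*v) (A ** Q) ` B = (*v) A ` W'"
    using f by (auto simp: AQ bij_betw_def)
  then have "vec.independent ((*v) (A ** Q) ` B)"
    using vec.independent_mono[OF A(5) image_mono[OF W'(1)]] by simp
  ultimately show thesis
    using that Q(1) by blast
qed

text \<open>Two proper subspaces never cover the space: with \<open>u\<close> outside the range and
  \<open>v\<close> outside the kernel, one of \<open>u\<close>, \<open>v\<close>,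
  \<open>u + v\<close> avoids both.\<close>

lemma ex_outside_kernel_and_range:
  fixes A :: "'k::field^'n^'n"
  assumes "\<not> invertible A" "A \<noteq> 0"
  obtains w where "A *v w \<noteq> 0" "w \<notin> range ((*v) A)"
proof -
  obtain u where u: "u \<notin> range ((*v) A)"
    using assms(1) by (auto simp: invertible_right_inverse matrix_right_invertible_surjective)
  obtain v where v: "A *v v \<noteq> 0"
    using assms(2) by (auto simp: matrix_eq)
  consider "A *v u \<noteq> 0" | "v \<notin> range ((*v) A)" | "A *v u = 0" "v \<in> range ((*v) A)"
    by blast
  then show thesis
  proof cases
    case 3
    then obtain y where y: "v = A *v y"
      by blast
    have "u + v \<notin> range ((*v) A)"
    proof
      assume "u + v \<in> range ((*v) A)"
      then obtain z where "u + v = A *v z"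
        by blast
      then have "u = A *v (z - y)"
        using y by (simp add: vec.diff eq_diff_eq)
      then show False
        using u by blast
    qed
    moreover have "A *v (u + v) \<noteq> 0"
      using 3 v by (simp add: vec.add)
    ultimately show thesis
      using that by blast
  qed (use that u v in blast)+
qed

text \<open>If \<open>Q *v x\<close> is outside the range of \<open>A\<close>, then \<open>x\<close>
  is outside the range of the conjugate of \<open>A\<close> by the inverse of \<open>Q\<close>. To
  keep the rank, \<open>Q\<close> sends \<open>x\<close> to some \<open>w\<close> that is also
  outside the kernel, and the rest of a basis of the range of \<open>N\<close> to preimages
  completing \<open>A *v w\<close> to a basis of the range of \<open>A\<close>.\<close>

lemma invertible_moving_out_of_range:
  fixes A N :: "'k::field^'n^'n"
  assumes "\<not> invertible A" "rank N = rank A" "x \<in> range ((*v) N)" "x \<noteq> 0"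
  obtains Q :: "'k^'n^'n" where "invertible Q" "Q *v x \<notin> range ((*v) A)" "rank (A ** Q ** N) = rank A"
proof -
  have "vec.independent {x}"
    using assms(4) by simp
  then obtain B where B: "{x} \<subseteq> B" "B \<subseteq> range ((*v) N)" "vec.independent B" "range ((*v) N) \<subseteq> vec.span B"
    using assms(3) vec.maximal_independent_subset_extend[of "{x}" "range ((*v) N)"] by auto
  have cardB: "card B = rank A"
    using vec.basis_card_eq_dim[OF B(2,4,3)] assms(2) by (simp add: rank_eq_dim_range)
  have finB: "finite B"
    using B(3) by (rule vec.finiteI_independent)
  have "rank A \<noteq> 0"
    using finB B(1) by (auto simp flip: cardB)
  then have "A \<noteq> 0"
    by (auto simp: rank_eq_dim_range)
  then obtain w where w: "A *v w \<noteq> 0" "w \<notin> range ((*v) A)"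
    using ex_outside_kernel_and_range assms(1) by blast
  have "vec.independent {A *v w}"
    using w(1) by simp
  then obtain C where C: "{A *v w} \<subseteq> C" "C \<subseteq> range ((*v) A)" "vec.independent C" "range ((*v) A) \<subseteq> vec.span C"
    using vec.maximal_independent_subset_extend[of "{A *v w}" "range ((*v) A)"] by auto
  have finC: "finite C"
    using C(3) by (rule vec.finiteI_independent)
  have cardC: "card C = rank A"
    using vec.basis_card_eq_dim[OF C(2,4,3)] by (simp add: rank_eq_dim_range)
  have "card (B - {x}) = card (C - {A *v w})"
    using cardB cardC B(1) C(1) finB finC by (simp add: card_Diff_singleton)
  then obtain f where f: "bij_betw f (B - {x}) (C - {A *v w})"
    using finite_same_card_bij finB finC by (metis finite_Diff)
  define h where "h b = (if b = x then w else (SOME v. A *v v = f b))" for b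
  define c where "c = f(x := A *v w)"
  have "\<exists>v. A *v v = f b" if "b \<in> B - {x}" for b
  proof -
    have "f b \<in> range ((*v) A)"
      using bij_betwE[OF f] that C(2) by blast
    then obtain v where "f b = A *v v"
      by blast
    then show ?thesis
      by (intro exI[of _ v]) simp
  qed
  then have some: "A *v (SOME v. A *v v = f b) = f b" if "b \<in> B - {x}" for b
    using that by (intro someI_ex[of "\<lambda>v. A *v v = f b"]) blast
  have Ah: "A *v h b = c b" if "b \<in> B" for b
    using that some by (simp add: h_def c_def)
  have c: "bij_betw c B C"
  proof -
    have "bij_betw c (B - {x}) (C - {A *v w})"
      using f by (rule bij_betw_cong[THEN iffD1, rotated]) (simp add: c_def)
    moreover have "bij_betw c {x} {A *v w}"
      by (simp add: c_def)
    ultimately have "bij_betw c (B - {x} \<union> {x}) (C - {A *v w} \<union> {A *v w})"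
      by (rule bij_betw_combine) auto
    then show ?thesis
      using B(1) C(1) by (simp add: insert_absorb)
  qed
  then have inj_c: "inj_on c B" and cB: "c ` B = C"
    by (simp_all add: bij_betw_def)
  have c_eq: "a = b" if "a \<in> B" "b \<in> B" "A *v h a = A *v h b" for a b
    using inj_onD[OF inj_c _ that(1,2)] that by (simp add: Ah)
  have inj_h: "inj_on h B"
    by (rule inj_onI) (simp add: c_eq)
  have AhB: "(*v) A ` h ` B = C"
    unfolding image_image cB[symmetric] by (rule image_cong) (auto simp: Ah)
  have "inj_on ((*v) A) (h ` B)"
    by (rule inj_onI, elim imageE) (metis c_eq)
  \<comment> \<open>Vectors with distinct independent images are independent: the case of an empty
    kernel part.\<close>
  then have "vec.independent (h ` B \<union> {})"
    using AhB C(3) by (intro independent_Un_kernel[of A]) (auto simp: vec.independent_empty)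
  then obtain Q where Q: "invertible Q" "\<And>b. b \<in> B \<Longrightarrow> Q *v b = h b"
    using invertible_extending[of B h] B(3) inj_h by auto
  have AQ: "(A ** Q) *v b = c b" if "b \<in> B" for b
    using that Q(2) Ah by (simp add: matrix_vector_mul_assoc[symmetric])
  have "vec.span B \<subseteq> range ((*v) N)"
    using B(2) by (intro vec.span_minimal vec.linear_subspace_image matrix_vector_mul_linear_gen vec.subspace_UNIV)
  then have "range ((*v) N) = vec.span (B \<union> {})"
    using B(4) by auto
  moreover have "inj_on ((*v) (A ** Q)) B"
    using inj_c by (simp add: AQ inj_on_def)
  moreover have "(*v) (A ** Q) ` B = C"
    unfolding cB[symmetric] by (rule image_cong) (auto simp: AQ)
  ultimately have "rank (A ** Q ** N) = rank A"
    using rank_mult_of_image_basis[of N B "{}" "A ** Q"] C(3) cardB by simp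
  moreover have "Q *v x \<notin> range ((*v) A)"
    using Q(2) B(1) w(2) by (simp add: h_def)
  ultimately show thesis
    using that Q(1) by blast
qed

subsection \<open>Invertible matrices differing from the identity in prescribed rows\<close>

text \<open>A chain of subgroups from \<open>{mat 1}\<close> at the empty set to the full linear
  group at \<open>UNIV\<close>; elimination becomes induction on \<open>J\<close>.\<close>

definition gl_rows :: "'n set \<Rightarrow> ('k::field^'n^'n) set" where
  "gl_rows J = {g. invertible g \<and> (\<forall>k. k \<notin> J \<longrightarrow> g $ k = mat 1 $ k)}"

lemma matrix_mult_row_cong:
  fixes g h :: "'k::semiring_1^'n^'m"
  assumes "g $ k = h $ k"
  shows "(g ** B) $ k = (h ** B) $ k"
  using assms by (simp add: matrix_matrix_mult_def vec_eq_iff)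

lemma mat_1_in_gl_rows: "mat 1 \<in> gl_rows J"
  by (auto simp: gl_rows_def invertible_def)

lemma gl_rows_mono: "I \<subseteq> J \<Longrightarrow> gl_rows I \<subseteq> gl_rows J"
  by (auto simp: gl_rows_def)

lemma gl_rows_mult:
  assumes "g \<in> gl_rows J" "h \<in> gl_rows J"
  shows "g ** h \<in> gl_rows J"
proof -
  have "(g ** h) $ k = mat 1 $ k" if "k \<notin> J" for k
    using that assms matrix_mult_row_cong[of g k "mat 1" h] by (simp add: gl_rows_def)
  then show ?thesis
    using assms by (simp add: gl_rows_def invertible_mult)
qed

lemma gl_rows_inverse:
  assumes "g \<in> gl_rows J" "g ** h = mat 1"
  shows "h \<in> gl_rows J"
proof -
  have "h $ k = mat 1 $ k" if "k \<notin> J" for k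
    using that assms matrix_mult_row_cong[of g k "mat 1" h] by (simp add: gl_rows_def)
  then show ?thesis
    using assms(2) by (auto simp: gl_rows_def invertible_left_inverse)
qed

text \<open>The identity rows force a kernel vector to vanish off \<open>j\<close>, and row
  \<open>j\<close> then forces its last coordinate to vanish.\<close>

lemma single_row_in_gl_rows:
  fixes h :: "'k::field^'n^'n"
  assumes "\<And>k. k \<noteq> j \<Longrightarrow> h $ k = mat 1 $ k" "h $ j $ j \<noteq> 0"
  shows "h \<in> gl_rows {j}"
proof -
  have "x = 0" if hx: "h *v x = 0" for x
  proof -
    have off: "x $ k = 0" if "k \<noteq> j" for k
    proof -
      have "(h *v x) $ k = (mat 1 *v x) $ k"
        using assms(1)[OF that] by (simp only: matrix_vector_mult_def vec_lambda_beta)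
      then show ?thesis
        using hx by simp
    qed
    have "(h *v x) $ j = (\<Sum>k\<in>UNIV. h $ j $ k * x $ k)"
      by (simp add: matrix_vector_mult_def)
    also have "\<dots> = (\<Sum>k\<in>UNIV. if k = j then h $ j $ j * x $ j else 0)"
      by (rule sum.cong) (auto simp: off)
    finally have "h $ j $ j * x $ j = 0"
      using hx by simp
    with off show "x = 0"
      using assms(2) by (metis mult_eq_0_iff vec_eq_iff zero_index)
  qed
  then show ?thesis
    using assms(1) by (auto simp: gl_rows_def invertible_left_inverse matrix_left_invertible_ker)
qed

text \<open>Take for \<open>h\<close> the identity with row \<open>j\<close> replaced by that of
  \<open>g\<close>. Outside \<open>J\<close> the rows of \<open>g\<close> and \<open>h\<close>
  agree, so \<open>g\<close> times the inverse of \<open>h\<close> has identity rows there.\<close>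

lemma gl_rows_insert_pivot:
  fixes g :: "'k::field^'n^'n"
  assumes "g \<in> gl_rows (insert j J)" "g $ j $ j \<noteq> 0"
  obtains y h where "y \<in> gl_rows J" "h \<in> gl_rows {j}" "g = y ** h"
proof -
  define h :: "'k^'n^'n" where "h = (\<chi> k. if k = j then g $ j else mat 1 $ k)"
  have h: "h \<in> gl_rows {j}"
    using assms(2) by (intro single_row_in_gl_rows) (auto simp: h_def)
  then obtain h' where h': "h ** h' = mat 1" "h' ** h = mat 1"
    by (auto simp: gl_rows_def invertible_def)
  have g: "g = g ** h' ** h"
    using h'(2) by (metis matrix_mul_assoc matrix_mul_rid)
  have "(g ** h') $ k = mat 1 $ k" if "k \<notin> J" for k
  proof -
    have "g $ k = h $ k"
      using that assms(1) by (auto simp: h_def gl_rows_def)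
    then show ?thesis
      using matrix_mult_row_cong[of g k h h'] h'(1) by simp
  qed
  moreover have "invertible (g ** h')"
    using assms(1) h' by (intro invertible_mult) (auto simp: gl_rows_def invertible_def)
  ultimately have "g ** h' \<in> gl_rows J"
    by (simp add: gl_rows_def)
  then show thesis
    using that h g by blast
qed

text \<open>If the pivot \<open>g $ j $ j\<close> vanishes, adding a column \<open>i\<close> with
  \<open>i \<in> J\<close> to column \<open>j\<close> repairs it; \<open>u\<close> undoes this
  operation.\<close>

lemma gl_rows_insert_cases:
  fixes g :: "'k::field^'n^'n"
  assumes "g \<in> gl_rows (insert j J)"
  obtains y h i u where "y \<in> gl_rows J" "h \<in> gl_rows {j}" "u = mat 1 \<or> i \<in> J \<and> u \<in> gl_rows {i}"
    "g = y ** h ** u"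
proof (cases "g $ j $ j = 0")
  case False
  then show thesis
    using that gl_rows_insert_pivot[OF assms] by (metis matrix_mul_rid)
next
  case True
  obtain g' where g': "g ** g' = mat 1"
    using assms by (auto simp: gl_rows_def invertible_def)
  \<comment> \<open>Diagonal entry \<open>j\<close> of \<open>g ** g'\<close> is 1, so some term is
    nonzero. Its first factor supplies the new pivot; its second shows that row \<open>i\<close> of
    \<open>g'\<close> is not an identity row, hence \<open>i \<in> J\<close>.\<close>
  then have "(\<Sum>k\<in>UNIV. g $ j $ k * g' $ k $ j) = 1"
    by (simp add: matrix_matrix_mult_def vec_eq_iff mat_def)
  then have "(\<Sum>k\<in>UNIV. g $ j $ k * g' $ k $ j) \<noteq> 0"
    by simp
  then obtain i where "g $ j $ i * g' $ i $ j \<noteq> 0"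
    by (rule sum.not_neutral_contains_not_neutral)
  then have i: "g $ j $ i \<noteq> 0" "g' $ i $ j \<noteq> 0"
    by auto
  have "i \<noteq> j"
    using i(1) True by blast
  have "i \<in> J"
  proof (rule ccontr)
    assume "i \<notin> J"
    then have "g' $ i = mat 1 $ i"
      using gl_rows_inverse[OF assms g'] \<open>i \<noteq> j\<close> by (simp add: gl_rows_def)
    then show False
      using i(2) \<open>i \<noteq> j\<close> by (simp add: mat_def)
  qed
  define v :: "'k^'n^'n" where "v = (\<chi> k l. mat 1 $ k $ l + (if k = i \<and> l = j then 1 else 0))"
  have v: "v \<in> gl_rows {i}"
    using \<open>i \<noteq> j\<close> by (intro single_row_in_gl_rows) (auto simp: v_def vec_eq_iff mat_def)
  then obtain u where u: "v ** u = mat 1"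
    by (auto simp: gl_rows_def invertible_def)
  have "(g ** v) $ j $ j = (\<Sum>k\<in>UNIV. g $ j $ k * mat 1 $ k $ j + (if k = i then g $ j $ k else 0))"
    by (auto simp: matrix_matrix_mult_def v_def algebra_simps intro!: sum.cong)
  also have "\<dots> = (g ** mat 1) $ j $ j + g $ j $ i"
    by (simp only: sum.distrib matrix_matrix_mult_def vec_lambda_beta) simp
  finally have "(g ** v) $ j $ j \<noteq> 0"
    using True i(1) by simp
  moreover have "g ** v \<in> gl_rows (insert j J)"
    using assms v gl_rows_mono[of "{i}" "insert j J"] \<open>i \<in> J\<close> by (intro gl_rows_mult) auto
  ultimately obtain y h where yh: "y \<in> gl_rows J" "h \<in> gl_rows {j}" "g ** v = y ** h"
    using gl_rows_insert_pivot[of "g ** v" j J] by blast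
  have "g = y ** h ** u"
    using yh(3) u by (metis matrix_mul_assoc matrix_mul_rid)
  then show thesis
    using that yh(1,2) gl_rows_inverse[OF v u] \<open>i \<in> J\<close> by blast
qed

text \<open>Column \<open>i\<close> of \<open>B\<close> vanishes, and in the product it is the only
  column that meets row \<open>i\<close> of \<open>h\<close>.\<close>

lemma matrix_mult_gl_rows_annihilated:
  fixes B :: "'k::field^'n^'m"
  assumes "B *v axis i 1 = 0" "h \<in> gl_rows {i}"
  shows "B ** h = B"
proof -
  have "B $ a $ i = 0" for a
  proof -
    have "(B *v axis i 1) $ a = (\<Sum>k\<in>UNIV. if k = i then B $ a $ i else 0)"
      unfolding matrix_vector_mult_def vec_lambda_beta by (rule sum.cong) (auto simp: axis_def)
    then show ?thesis
      using assms(1) by simp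
  qed
  then have "B $ a $ k * h $ k $ b = B $ a $ k * mat 1 $ k $ b" for a b k
    using assms(2) by (cases "k = i") (auto simp: gl_rows_def)
  then have "(B ** h) $ a $ b = (B ** mat 1) $ a $ b" for a b
    by (simp only: matrix_matrix_mult_def vec_lambda_beta)
  then show ?thesis
    by (simp add: vec_eq_iff)
qed

subsection \<open>The semigroup generated by a similarity class\<close>

lemma foldl_matrix_mult: "Z ** foldl (**) Y Ys = foldl (**) (Z ** Y) Ys"
  for Z :: "'k::semiring_1^'n^'n"
  by (induction Ys arbitrary: Y) (simp_all add: matrix_mul_assoc)

lemma generated_semigroup_base: "Y \<in> X \<Longrightarrow> Y \<in> generated_semigroup X"
  unfolding generated_semigroup_def by (intro CollectI exI[of _ Y] exI[of _ "[]"]) simp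

lemma generated_semigroup_mult:
  assumes "M \<in> generated_semigroup X" "N \<in> generated_semigroup X"
  shows "M ** N \<in> generated_semigroup X"
proof -
  obtain Y Ys Z Zs where "M = foldl (**) Y Ys" "Y \<in> X" "set Ys \<subseteq> X"
    "N = foldl (**) Z Zs" "Z \<in> X" "set Zs \<subseteq> X"
    using assms by (auto simp: generated_semigroup_def)
  moreover from this have "M ** N = foldl (**) Y (Ys @ Z # Zs)"
    by (simp add: foldl_matrix_mult)
  ultimately show ?thesis
    unfolding generated_semigroup_def by (intro CollectI exI[of _ Y] exI[of _ "Ys @ Z # Zs"]) simp
qed

lemma generated_semigroup_induct [consumes 1, case_names base mult]:
  assumes "M \<in> generated_semigroup X"
    and "\<And>Y. Y \<in> X \<Longrightarrow> P Y"
    and "\<And>M Y. M \<in> generated_semigroup X \<Longrightarrow> P M \<Longrightarrow> Y \<in> X \<Longrightarrow> P (M ** Y)"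
  shows "P M"
proof -
  obtain Y Ys where M: "M = foldl (**) Y Ys" "Y \<in> X" "set Ys \<subseteq> X"
    using assms(1) by (auto simp: generated_semigroup_def)
  have "foldl (**) Y Ys \<in> generated_semigroup X \<and> P (foldl (**) Y Ys)"
    using M(3)
  proof (induction Ys rule: rev_induct)
    case Nil
    then show ?case
      using M(2) assms(2) by (simp add: generated_semigroup_base)
  next
    case (snoc Z Zs)
    then show ?case
      using assms(3) by (simp add: generated_semigroup_mult generated_semigroup_base)
  qed
  then show ?thesis
    using M(1) by simp
qed

text \<open>Replaces the chosen inverse \<open>matrix_inv P\<close> by any \<open>Q\<close> with
  \<open>P ** Q = mat 1\<close>; for square matrices a one-sided inverse is two-sided and
  unique.\<close>

lemma similarity_class_iff:
  "B \<in> similarity_class A \<longleftrightarrow> (\<exists>P Q. P ** Q = mat 1 \<and> B = P ** A ** Q)"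
proof
  assume "B \<in> similarity_class A"
  then obtain P where P: "invertible P" "B = P ** A ** matrix_inv P"
    by (auto simp: similarity_class_def)
  have "P ** matrix_inv P = mat 1"
    using P(1) unfolding invertible_def matrix_inv_def by (rule someI2_ex) simp
  with P(2) show "\<exists>P Q. P ** Q = mat 1 \<and> B = P ** A ** Q"
    by blast
next
  assume "\<exists>P Q. P ** Q = mat 1 \<and> B = P ** A ** Q"
  then obtain P Q where PQ: "P ** Q = mat 1" "B = P ** A ** Q"
    by blast
  then have QP: "Q ** P = mat 1"
    using matrix_left_right_inverse by blast
  then have "matrix_inv P ** P = mat 1"
    unfolding matrix_inv_def using PQ(1) by (rule_tac someI2) auto
  then have "matrix_inv P = Q"
    using PQ(1) by (metis matrix_mul_assoc matrix_mul_lid matrix_mul_rid)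
  moreover have "invertible P"
    using PQ(1) QP by (auto simp: invertible_def)
  ultimately show "B \<in> similarity_class A"
    using PQ(2) by (auto simp: similarity_class_def)
qed

lemma similarity_class_conj:
  assumes "B \<in> similarity_class A" "P ** Q = mat 1"
  shows "P ** B ** Q \<in> similarity_class A"
proof -
  obtain R S where RS: "R ** S = mat 1" "B = R ** A ** S"
    using assms(1) similarity_class_iff by blast
  have "(P ** R) ** (S ** Q) = mat 1"
    using RS(1) assms(2) by (metis matrix_mul_assoc matrix_mul_rid)
  moreover have "P ** B ** Q = (P ** R) ** A ** (S ** Q)"
    by (simp add: RS(2) matrix_mul_assoc)
  ultimately show ?thesis
    using similarity_class_iff by blast
qed

lemma similarity_class_self: "A \<in> similarity_class A"
  using similarity_class_iff[of A A] by (metis matrix_mul_lid matrix_mul_rid)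

lemma rank_similarity_class:
  assumes "B \<in> similarity_class A"
  shows "rank B = rank A"
proof -
  obtain P Q where PQ: "P ** Q = mat 1" "B = P ** A ** Q"
    using assms similarity_class_iff by blast
  then have "invertible P" "invertible Q"
    using invertible_right_inverse[of P] invertible_left_inverse[of Q] by blast+
  then show ?thesis
    by (simp add: PQ(2) rank_mult_invertible_left rank_mult_invertible_right)
qed


text \<open>\<open>X\<close> collects the left multipliers that keep \<open>N\<close> in the
  semigroup. Their invertibility lets a further conjugate be put in front of \<open>N\<close>; the
  rank condition makes \<open>N\<close> equivalent to every matrix of the rank of
  \<open>A\<close>.\<close>

definition absorbing :: "'k::field^'n^'n \<Rightarrow> ('k^'n^'n) set \<Rightarrow> 'k^'n^'n \<Rightarrow> bool" where
  "absorbing A X N \<longleftrightarrow> N \<in> generated_semigroup (similarity_class A) \<and> rank N = rank A \<and>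
     (\<forall>g\<in>X. invertible g \<and> g ** N \<in> generated_semigroup (similarity_class A))"

lemma absorbing_mult:
  assumes "absorbing A X N" "B \<in> similarity_class A" "rank (B ** N) = rank A"
  shows "absorbing A X (B ** N)"
  unfolding absorbing_def
proof (intro conjI ballI)
  show "B ** N \<in> generated_semigroup (similarity_class A)"
    using assms(1,2) by (simp add: absorbing_def generated_semigroup_base generated_semigroup_mult)
  show "rank (B ** N) = rank A" by fact
  fix g
  assume "g \<in> X"
  then have g: "invertible g" "g ** N \<in> generated_semigroup (similarity_class A)"
    using assms(1) by (auto simp: absorbing_def)
  show "invertible g" by fact
  obtain g' where g': "g ** g' = mat 1" "g' ** g = mat 1"
    using g(1) by (auto simp: invertible_def)
  have "g ** (B ** N) = g ** B ** (g' ** g) ** N"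
    by (simp add: g'(2) matrix_mul_assoc)
  also have "\<dots> = (g ** B ** g') ** (g ** N)"
    by (simp only: matrix_mul_assoc)
  finally show "g ** (B ** N) \<in> generated_semigroup (similarity_class A)"
    using similarity_class_conj[OF assms(2) g'(1)] g(2)
    by (simp add: generated_semigroup_base generated_semigroup_mult)
qed

text \<open>Since \<open>h ** B\<close> is again a conjugate of \<open>A\<close>, the multiplier
  \<open>h\<close> is absorbed by the new factor, and \<open>g\<close> by
  \<open>absorbing_mult\<close> applied to \<open>h ** B\<close>.\<close>

lemma absorbing_annihilating_mult:
  assumes "absorbing A X N" "B \<in> similarity_class A" "rank (B ** N) = rank A" "B *v axis i 1 = 0"
  shows "absorbing A {g ** h | g h. g \<in> X \<and> h \<in> gl_rows {i}} (B ** N)"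
proof -
  have *: "invertible (g ** h) \<and> g ** h ** (B ** N) \<in> generated_semigroup (similarity_class A)"
    if g: "g \<in> X" and h: "h \<in> gl_rows {i}" for g h
  proof -
    obtain h' where h': "h ** h' = mat 1"
      using h by (auto simp: gl_rows_def invertible_def)
    have "B = B ** h ** h'"
      using h' by (metis matrix_mul_assoc matrix_mul_rid)
    then have "B = B ** h'"
      by (simp add: matrix_mult_gl_rows_annihilated[OF assms(4) h])
    then have hB: "h ** B = h ** B ** h'"
      by (metis matrix_mul_assoc)
    then have "h ** B \<in> similarity_class A"
      using similarity_class_conj[OF assms(2) h'] by simp
    moreover have "rank (h ** B ** N) = rank A"
      using h assms(3) by (simp add: gl_rows_def rank_mult_invertible_left flip: matrix_mul_assoc)
    ultimately have "absorbing A X (h ** B ** N)"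
      using assms(1) by (intro absorbing_mult) auto
    then show ?thesis
      using g h by (auto simp: absorbing_def gl_rows_def matrix_mul_assoc intro: invertible_mult)
  qed
  show ?thesis
    using absorbing_mult[OF assms(1-3)] * by (auto simp: absorbing_def)
qed

text \<open>A factor killing a nonzero \<open>x\<close> in the range of \<open>N\<close> would lower
  the rank. One extra conjugate first moves the range off \<open>x\<close>.\<close>

lemma absorbing_ex_avoiding:
  fixes A :: "'k::field^'n^'n"
  assumes "\<not> invertible A" "absorbing A X N" "x \<noteq> 0"
  obtains N' where "absorbing A X N'" "x \<notin> range ((*v) N')"
proof (cases "x \<in> range ((*v) N)")
  case True
  have "rank N = rank A"
    using assms(2) by (simp add: absorbing_def)
  then obtain Q where Q: "invertible Q" "Q *v x \<notin> range ((*v) A)" "rank (A ** Q ** N) = rank A"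
    using invertible_moving_out_of_range[OF assms(1) _ True assms(3)] by blast
  obtain P where P: "P ** Q = mat 1" "Q ** P = mat 1"
    using Q(1) by (auto simp: invertible_def)
  have "invertible P"
    using P by (auto simp: invertible_def)
  then have "rank (P ** A ** Q ** N) = rank A"
    using Q(3) by (simp add: rank_mult_invertible_left flip: matrix_mul_assoc)
  moreover have "P ** A ** Q \<in> similarity_class A"
    using P(1) similarity_class_iff by blast
  moreover have "x \<notin> range ((*v) (P ** A ** Q ** N))"
  proof
    assume "x \<in> range ((*v) (P ** A ** Q ** N))"
    then obtain y where "x = P ** A ** Q ** N *v y"
      by blast
    then have "Q *v x = (Q ** P) ** A ** Q ** N *v y"
      by (simp only: matrix_vector_mul_assoc matrix_mul_assoc)
    then have "Q *v x = A *v (Q ** N *v y)"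
      by (simp add: P(2) matrix_vector_mul_assoc matrix_mul_assoc)
    then show False
      using Q(2) by blast
  qed
  ultimately show thesis
    using that absorbing_mult[OF assms(2)] by blast
qed (use that assms(2) in blast)

text \<open>Once e_i is outside the range of \<open>M\<close>, a conjugate of \<open>A\<close> can
  kill e_i and still be injective on that range, so the rank survives.\<close>

lemma absorbing_extend:
  fixes A :: "'k::field^'n^'n"
  assumes "\<not> invertible A" "absorbing A X N"
  obtains N' where "absorbing A {g ** h | g h. g \<in> X \<and> h \<in> gl_rows {i}} N'"
proof -
  define x :: "'k^'n" where "x = axis i 1"
  have "x \<noteq> 0"
    by (simp add: x_def axis_eq_0_iff)
  then obtain M where M: "absorbing A X M" "x \<notin> range ((*v) M)"
    using absorbing_ex_avoiding[OF assms] by blast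
  obtain B where B: "B \<subseteq> range ((*v) M)" "vec.independent B" "range ((*v) M) \<subseteq> vec.span B"
    "card B = vec.dim (range ((*v) M))"
    by (rule vec.basis_exists)
  have "vec.span B \<subseteq> range ((*v) M)"
    using B(1) by (intro vec.span_minimal vec.linear_subspace_image matrix_vector_mul_linear_gen vec.subspace_UNIV)
  with B(3) have span: "range ((*v) M) = vec.span B"
    by blast
  have card: "card B = rank A"
    using B(4) M(1) by (simp add: absorbing_def rank_eq_dim_range)
  obtain Q where Q: "invertible Q" "(A ** Q) *v x = 0"
    "inj_on ((*v) (A ** Q)) B" "vec.independent ((*v) (A ** Q) ` B)"
    using invertible_annihilating[OF assms(1) B(2), of x] M(2) span card by auto
  obtain P where P: "P ** Q = mat 1" "Q ** P = mat 1"
    using Q(1) by (auto simp: invertible_def)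
  have "rank (A ** Q ** M) = rank A"
    using rank_mult_of_image_basis[of M B "{}" "A ** Q"] span Q(3,4) card by simp
  moreover have "invertible P"
    using P by (auto simp: invertible_def)
  ultimately have "rank (P ** A ** Q ** M) = rank A"
    by (simp add: rank_mult_invertible_left flip: matrix_mul_assoc)
  moreover have "P ** A ** Q \<in> similarity_class A"
    using P(1) similarity_class_iff by blast
  moreover have "P ** A ** Q *v axis i 1 = 0"
    using Q(2) by (simp add: x_def flip: matrix_mul_assoc matrix_vector_mul_assoc)
  ultimately show thesis
    using that absorbing_annihilating_mult[OF M(1)] by blast
qed

text \<open>
  The pivot column used in \<open>gl_rows_insert_cases\<close> depends on the matrix, whereas \<open>N\<close> must not; so room is made
  for every possible pivot in advance.
\<close>

lemma absorbing_extend_finite: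
  fixes A :: "'k::field^'n^'n"
  assumes "\<not> invertible A" "absorbing A X N" "finite I"
  shows "\<exists>Y N'. absorbing A Y N' \<and> X \<subseteq> Y \<and> (\<forall>g\<in>X. \<forall>i\<in>I. \<forall>u\<in>gl_rows {i}. g ** u \<in> Y)"
  using assms(3)
proof (induction I)
  case empty
  then show ?case
    using assms(2) by auto
next
  case (insert i I)
  then obtain Y N' where Y: "absorbing A Y N'" "X \<subseteq> Y" "\<forall>g\<in>X. \<forall>i\<in>I. \<forall>u\<in>gl_rows {i}. g ** u \<in> Y"
    by blast
  define Z where "Z = {g ** h | g h. g \<in> Y \<and> h \<in> (gl_rows {i} :: ('k^'n^'n) set)}"
  obtain N'' where N'': "absorbing A Z N''"
    unfolding Z_def by (rule absorbing_extend[OF assms(1) Y(1)])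
  \<comment> \<open>The choice \<open>h = mat 1\<close> retains all earlier multipliers.\<close>
  have "Y \<subseteq> Z"
  proof
    fix g
    assume "g \<in> Y"
    then show "g \<in> Z"
      unfolding Z_def using mat_1_in_gl_rows by (intro CollectI exI[of _ g] exI[of _ "mat 1"]) auto
  qed
  moreover have "g ** u \<in> Z" if "g \<in> X" "u \<in> gl_rows {i}" for g u
    unfolding Z_def using that Y(2) by blast
  ultimately have "X \<subseteq> Z" "\<forall>g\<in>X. \<forall>k\<in>insert i I. \<forall>u\<in>gl_rows {k}. g ** u \<in> Z"
    using Y(2,3) by blast+
  then show ?case
    using N'' by blast
qed

lemma absorbing_subset: "absorbing A Y N \<Longrightarrow> X \<subseteq> Y \<Longrightarrow> absorbing A X N"
  by (auto simp: absorbing_def)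

text \<open>In the induction step, first make room for the factor in row \<open>j\<close>, then for
  a last factor in any row of the finite set \<open>J\<close>; \<open>gl_rows_insert_cases\<close>
  shows that this covers \<open>gl_rows (insert j J)\<close>.\<close>

lemma absorbing_gl_rows:
  fixes A :: "'k::field^'n^'n"
  assumes "\<not> invertible A" "finite J"
  shows "\<exists>N. absorbing A (gl_rows J) N"
  using assms(2)
proof (induction J)
  case empty
  have "(gl_rows {} :: ('k^'n^'n) set) = {mat 1}"
    by (auto simp: gl_rows_def vec_eq_iff invertible_def)
  then have "absorbing A (gl_rows {}) A"
    by (auto simp: absorbing_def invertible_def intro: generated_semigroup_base similarity_class_self)
  then show ?case
    by blast
next
  case (insert j J)
  then obtain N where "absorbing A (gl_rows J) N"
    by blast
  then obtain N' where "absorbing A {g ** h | g h. g \<in> gl_rows J \<and> h \<in> gl_rows {j}} N'"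
    by (rule absorbing_extend[OF assms(1)])
  from absorbing_extend_finite[OF assms(1) this insert.hyps(1)] obtain Y M where Y: "absorbing A Y M"
    "{g ** h | g h. g \<in> gl_rows J \<and> h \<in> gl_rows {j}} \<subseteq> Y"
    "\<forall>g\<in>{g ** h | g h. g \<in> gl_rows J \<and> h \<in> gl_rows {j}}. \<forall>i\<in>J. \<forall>u\<in>gl_rows {i}. g ** u \<in> Y"
    by blast
  have "gl_rows (insert j J) \<subseteq> Y"
  proof
    fix g :: "'k^'n^'n"
    assume "g \<in> gl_rows (insert j J)"
    then obtain y h i u where g: "y \<in> gl_rows J" "h \<in> gl_rows {j}"
      "u = mat 1 \<or> i \<in> J \<and> u \<in> gl_rows {i}" "g = y ** h ** u"
      by (rule gl_rows_insert_cases)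
    then have yh: "y ** h \<in> {g ** h | g h. g \<in> gl_rows J \<and> h \<in> gl_rows {j}}"
      by blast
    from g(3) show "g \<in> Y"
    proof
      assume "u = mat 1"
      then show ?thesis
        using yh Y(2) g(4) by auto
    next
      assume "i \<in> J \<and> u \<in> gl_rows {i}"
      then show ?thesis
        using yh Y(3) g(4) by blast
    qed
  qed
  then show ?case
    using absorbing_subset[OF Y(1)] by blast
qed

section \<open>From absorbing products to all matrices of rank at most that of
  \<open>A\<close>\<close>

lemma generated_semigroup_conj:
  assumes "M \<in> generated_semigroup (similarity_class A)" "P ** Q = mat 1"
  shows "P ** M ** Q \<in> generated_semigroup (similarity_class A)"
  using assms(1)
proof (induction rule: generated_semigroup_induct)
  case (base Y)
  then show ?case
    using assms(2) by (intro generated_semigroup_base similarity_class_conj)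
next
  case (mult M Y)
  have "Q ** P = mat 1"
    using assms(2) matrix_left_right_inverse by blast
  then have "P ** (M ** Y) ** Q = P ** M ** (Q ** P) ** Y ** Q"
    by (simp add: matrix_mul_assoc)
  also have "\<dots> = (P ** M ** Q) ** (P ** Y ** Q)"
    by (simp only: matrix_mul_assoc)
  finally show ?case
    using mult assms(2)
    by (simp add: generated_semigroup_mult generated_semigroup_base similarity_class_conj)
qed

text \<open>With \<open>R\<close> inverse to \<open>Q\<close>, the matrix \<open>P ** N ** Q\<close>
  is the conjugate by \<open>R\<close> of \<open>Q ** P ** N\<close>, so left multipliers of
  \<open>N\<close> suffice.\<close>

lemma rank_eq_in_generated_semigroup:
  fixes A M :: "'k::field^'n^'n"
  assumes "\<not> invertible A" "rank M = rank A"
  shows "M \<in> generated_semigroup (similarity_class A)"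
proof -
  obtain N where N: "absorbing A (gl_rows UNIV) N"
    using absorbing_gl_rows[OF assms(1) finite] by blast
  then have "rank M = rank N"
    using assms(2) by (simp add: absorbing_def)
  then obtain P Q where PQ: "invertible P" "invertible Q" "M = P ** N ** Q"
    by (rule same_rank_equivalent)
  obtain R where R: "R ** Q = mat 1"
    using PQ(2) by (auto simp: invertible_def)
  have "Q ** P \<in> gl_rows UNIV"
    using PQ(1,2) by (simp add: gl_rows_def invertible_mult)
  then have "Q ** P ** N \<in> generated_semigroup (similarity_class A)"
    using N by (auto simp: absorbing_def)
  then have "R ** (Q ** P ** N) ** Q \<in> generated_semigroup (similarity_class A)"
    using R by (rule generated_semigroup_conj)
  moreover have "R ** (Q ** P ** N) ** Q = (R ** Q) ** P ** N ** Q"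
    by (simp only: matrix_mul_assoc)
  ultimately show ?thesis
    using R PQ(3) by simp
qed

text \<open>Only the first factor of the product changes, and it keeps the rank of
  \<open>A\<close>.\<close>

lemma generated_semigroup_invertible_mult:
  fixes A :: "'k::field^'n^'n"
  assumes "\<not> invertible A" "M \<in> generated_semigroup (similarity_class A)" "invertible g"
  shows "g ** M \<in> generated_semigroup (similarity_class A)"
  using assms(2)
proof (induction rule: generated_semigroup_induct)
  case (base Y)
  then show ?case
    using assms(1,3)
    by (intro rank_eq_in_generated_semigroup) (simp_all add: rank_mult_invertible_left rank_similarity_class)
next
  case (mult M Y)
  then show ?case
    by (simp add: matrix_mul_assoc generated_semigroup_mult generated_semigroup_base)
qed

lemma same_rank_in_generated_semigroup:
  fixes A :: "'k::field^'n^'n"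
  assumes "\<not> invertible A" "N \<in> generated_semigroup (similarity_class A)" "rank M = rank N"
  shows "M \<in> generated_semigroup (similarity_class A)"
proof -
  obtain P Q where PQ: "invertible P" "invertible Q" "M = P ** N ** Q"
    using assms(3) by (rule same_rank_equivalent)
  obtain R where R: "R ** Q = mat 1"
    using PQ(2) by (auto simp: invertible_def)
  have "R ** (Q ** P ** N) ** Q \<in> generated_semigroup (similarity_class A)"
    using assms(1,2) PQ(1,2) R
    by (intro generated_semigroup_conj generated_semigroup_invertible_mult invertible_mult)
  moreover have "R ** (Q ** P ** N) ** Q = (R ** Q) ** P ** N ** Q"
    by (simp only: matrix_mul_assoc)
  ultimately show ?thesis
    using R PQ(3) by simp
qed

lemma generated_semigroup_ex_rank:
  fixes A :: "'k::field^'n^'n"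
  assumes "\<not> invertible A" "r \<le> rank A"
  shows "\<exists>N\<in>generated_semigroup (similarity_class A). rank N = r"
  using assms(2)
proof (induction rule: inc_induct)
  case base
  then show ?case
    using generated_semigroup_base[OF similarity_class_self] by blast
next
  case (step r)
  then obtain N where N: "N \<in> generated_semigroup (similarity_class A)" "rank N = Suc r"
    by blast
  obtain C where C: "C \<subseteq> range ((*v) N)" "vec.independent C" "range ((*v) N) \<subseteq> vec.span C"
    "card C = vec.dim (range ((*v) N))"
    by (rule vec.basis_exists)
  have "vec.span C \<subseteq> range ((*v) N)"
    using C(1) by (intro vec.span_minimal vec.linear_subspace_image matrix_vector_mul_linear_gen vec.subspace_UNIV)
  with C(3) have span: "range ((*v) N) = vec.span C"
    by blast
  have "card C = Suc r"
    using C(4) N(2) by (simp add: rank_eq_dim_range)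
  then obtain x B where B: "C = insert x B" "x \<notin> B" "card B = r"
    by (auto simp: card_Suc_eq)
  then have "vec.independent B" "x \<notin> vec.span B"
    using C(2) by (auto simp: vec.independent_insert)
  then obtain Q where Q: "invertible Q" "(A ** Q) *v x = 0"
    "inj_on ((*v) (A ** Q)) B" "vec.independent ((*v) (A ** Q) ` B)"
    using invertible_annihilating[OF assms(1), of B x] B(3) step.hyps by auto
  \<comment> \<open>\<open>A ** Q\<close> need not be a conjugate of \<open>A\<close>, but it has
    the rank of \<open>A\<close> and hence lies in the semigroup.\<close>
  have "rank (A ** Q) = rank A"
    using Q(1) by (rule rank_mult_invertible_right)
  then have "A ** Q \<in> generated_semigroup (similarity_class A)"
    by (rule rank_eq_in_generated_semigroup[OF assms(1)])
  then have "A ** Q ** N \<in> generated_semigroup (similarity_class A)"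
    using N(1) by (rule generated_semigroup_mult)
  \<comment> \<open>Of the basis \<open>insert x B\<close> of the range of \<open>N\<close>, the
    vector \<open>x\<close> is killed and the \<open>r\<close> vectors of \<open>B\<close> keep
    independent images.\<close>
  moreover have "rank (A ** Q ** N) = r"
    using rank_mult_of_image_basis[of N B "{x}" "A ** Q"] span Q(2-4) B by simp
  ultimately show ?case
    by blast
qed

theorem theorem1:
  fixes A :: "'k::field^'n^'n" and p :: nat
  assumes "\<not> invertible A" and "rank A = p"
  shows "generated_semigroup (similarity_class A) = {M :: 'k^'n^'n. rank M \<le> p}"
proof (intro set_eqI iffI)
  fix M
  assume "M \<in> generated_semigroup (similarity_class A)"
  then have "rank M \<le> p"
  proof (induction rule: generated_semigroup_induct)
    case (base Y)
    then show ?case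
      using assms(2) by (simp add: rank_similarity_class)
  next
    case (mult M Y)
    then show ?case
      using rank_mult_le_left[of M Y] by simp
  qed
  then show "M \<in> {M. rank M \<le> p}"
    by simp
next
  fix M :: "'k^'n^'n"
  assume "M \<in> {M. rank M \<le> p}"
  then have "rank M \<le> rank A"
    using assms(2) by simp
  then obtain N where "N \<in> generated_semigroup (similarity_class A)" "rank N = rank M"
    using generated_semigroup_ex_rank[OF assms(1)] by blast
  then show "M \<in> generated_semigroup (similarity_class A)"
    using same_rank_in_generated_semigroup[OF assms(1)] by simp
qed

end
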